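(* Let $S=(I,U)$ be a finite connected oriented network without loops and multiple arcs, let $K=\{1,\ldots,|K|\}$ be a finite set of flow types, and let $S^k=(I^k,U^k)$, $k\in K$, be the associated connected networks. A family $U_T=\{U_T^k\subseteq U^k,\ k\in K\}$ of arc sets is a support of the network $S$ for the system $$\sum_{j\in I_i^+(U^k)}x_{ij}^k-\sum_{j\in I_i^-(U^k)}x_{ji}^k=a_i^k,\qquad i\in I^k,\ k\in K,$$ if and only if for each $k\in K$ the set of arcs $U_T^k$ is a spanning tree for the network $S^k=(I^k,U^k)$.
   Context: $S=(I,U)$ has a finite node set $I$ and a finite arc set $U\subseteq I\times I$ of directed arcs (no loops, no multiple arcs); connectedness, trees and cycles are understood ignoring orientation. For each $k\in K$ one is given a subset $\widetilde U^k\subseteq U$ (the arcs carrying flow of type $k$) and a node set $I^k\subseteq I$ containing the endpoints of these arcs; $U^k=\{(i,j)^k:(i,j)\in\widetilde U^k\}$ is a copy of $\widetilde U^k$ labelled by $k$, and $S^k=(I^k,U^k)$ is assumed connected (in particular $I^k\neq\emptyset$). The $a_i^k$ are real parameters. For a set of arcs $V\subseteq U^k$ write $I_i^+(V)=\{j\in I^k:(i,j)^k\in V\}$ and $I_i^-(V)=\{j\in I^k:(j,i)^k\in V\}$. Definition (support). The family $U_T=\{U_T^k\subseteq U^k,\ k\in K\}$ is a support of $S$ for the system $$\sum_{j\in I_i^+(U^k)}x_{ij}^k-\sum_{j\in I_i^-(U^k)}x_{ji}^k=a_i^k,\qquad i\in I^k,\ k\in K,$$ in the real unknowns $x_{ij}^k$,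 $(i,j)^k\in U^k$, $k\in K$, if the homogeneous system $$\sum_{j\in I_i^+(\hat U^k)}x_{ij}^k-\sum_{j\in I_i^-(\hat U^k)}x_{ji}^k=0,\qquad i\in I^k,\ k\in K,$$ in the real unknowns $x_{ij}^k$, $(i,j)^k\in\hat U^k$, $k\in K$, has only the trivial solution when $\hat U^k=U_T^k$ for all $k\in K$, but has a non-trivial solution when, for any $k_0\in K$ and any arc $(i,j)^{k_0}\in U^{k_0}\setminus U_T^{k_0}$, one takes $\hat U^k=U_T^k$ for $k\in K\setminus\{k_0\}$ and $\hat U^{k_0}=U_T^{k_0}\cup\{(i,j)^{k_0}\}$. A spanning tree for $S^k$ is a set of arcs of $U^k$ that, ignoring orientation, forms a tree whose node set is all of $I^k$. *)

theory Defs
  imports Complex_Main "Graph_Theory.Digraph_Component"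
begin

text \<open>
  The library notions \<^term>\<open>forest\<close>, \<^term>\<open>tree\<close> and \<^term>\<open>spanning_tree\<close> exclude only
  directed cycles, so they are not the notions meant when orientation is ignored
  (\<^term>\<open>Digraph_Component.connected\<close> and \<^term>\<open>spanning\<close> are).  The definitions below mirror
  them for the underlying undirected multigraph.

  In \<open>traversal G\<close> every arc \<open>e\<close> of \<open>G\<close> can be passed forwards, as \<open>(e, True)\<close>, and backwards,
  as \<open>(e, False)\<close>.  Requiring the underlying arcs of a cycle to be pairwise distinct excludes
  going back and forth along a single arc, whereas two antiparallel arcs \<open>(i, j)\<close> and \<open>(j, i)\<close>
  do form a cycle.
\<close>

definition traversal :: "('a, 'b) pre_digraph \<Rightarrow> ('a, 'b \<times> bool) pre_digraph" where
  "traversal G = \<lparr> verts = verts G, arcs = arcs G \<times> UNIV,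
     tail = (\<lambda>(e, fwd). if fwd then tail G e else head G e),
     head = (\<lambda>(e, fwd). if fwd then head G e else tail G e) \<rparr>"

definition undirected_cycle :: "('a, 'b) pre_digraph \<Rightarrow> ('b \<times> bool) awalk \<Rightarrow> bool" where
  "undirected_cycle G p \<longleftrightarrow> pre_digraph.cycle (traversal G) p \<and> distinct (map fst p)"

definition undirected_tree :: "('a, 'b) pre_digraph \<Rightarrow> bool" where
  "undirected_tree G \<longleftrightarrow> Digraph_Component.connected G \<and> \<not> (\<exists>p. undirected_cycle G p)"

definition spanning_tree_arcs :: "'a rel \<Rightarrow> 'a pair_pre_digraph \<Rightarrow> bool" where
  "spanning_tree_arcs V G \<longleftrightarrow>
     (let H = \<lparr> pverts = pverts G, parcs = V \<rparr>
      in undirected_tree (with_proj H) \<and> spanning (with_proj H) (with_proj G))"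

definition out_nodes :: "'a set \<Rightarrow> 'a rel \<Rightarrow> 'a \<Rightarrow> 'a set" where
  "out_nodes I V i = {j \<in> I. (i, j) \<in> V}"

definition in_nodes :: "'a set \<Rightarrow> 'a rel \<Rightarrow> 'a \<Rightarrow> 'a set" where
  "in_nodes I V i = {j \<in> I. (j, i) \<in> V}"

text \<open>
  Arcs of different flow types are kept apart by indexing: \<open>V k\<close> is the set of arcs of type \<open>k\<close>,
  and \<open>x k (i, j)\<close> is the flow of type \<open>k\<close> on \<open>(i, j)\<close>.  Only the values \<open>x k e\<close> with \<open>k \<in> K\<close>
  and \<open>e \<in> V k\<close> are unknowns of the system.
\<close>

definition balance_system ::
    "'k set \<Rightarrow> ('k \<Rightarrow> 'a set) \<Rightarrow> ('k \<Rightarrow> 'a rel) \<Rightarrow> ('k \<Rightarrow> 'a \<Rightarrow> real)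
      \<Rightarrow> ('k \<Rightarrow> 'a \<times> 'a \<Rightarrow> real) \<Rightarrow> bool" where
  "balance_system K I V a x \<longleftrightarrow>
     (\<forall>k\<in>K. \<forall>i\<in>I k.
        (\<Sum>j\<in>out_nodes (I k) (V k) i. x k (i, j)) - (\<Sum>j\<in>in_nodes (I k) (V k) i. x k (j, i)) = a k i)"

definition has_nontrivial_homogeneous_solution ::
    "'k set \<Rightarrow> ('k \<Rightarrow> 'a set) \<Rightarrow> ('k \<Rightarrow> 'a rel) \<Rightarrow> bool" where
  "has_nontrivial_homogeneous_solution K I V \<longleftrightarrow>
     (\<exists>x. balance_system K I V (\<lambda>_ _. 0) x \<and> (\<exists>k\<in>K. \<exists>e\<in>V k. x k e \<noteq> 0))"

text \<open>
  The arguments \<open>I\<close>, \<open>U\<close>, \<open>a\<close> are the data of the system for which \<open>T\<close> is a support.  The right-hand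
  side \<open>a\<close> has no influence, since the definition refers to homogeneous systems only.
\<close>

definition is_support ::
    "'k set \<Rightarrow> ('k \<Rightarrow> 'a set) \<Rightarrow> ('k \<Rightarrow> 'a rel) \<Rightarrow> ('k \<Rightarrow> 'a \<Rightarrow> real) \<Rightarrow> ('k \<Rightarrow> 'a rel) \<Rightarrow> bool" where
  "is_support K I U a T \<longleftrightarrow>
     (\<forall>k\<in>K. T k \<subseteq> U k) \<and>
     \<not> has_nontrivial_homogeneous_solution K I T \<and>
     (\<forall>k\<^sub>0\<in>K. \<forall>e\<in>U k\<^sub>0 - T k\<^sub>0.
        has_nontrivial_homogeneous_solution K I (T(k\<^sub>0 := T k\<^sub>0 \<union> {e})))"

end

theory Submission
  imports Defs
begin

text \<open>
  The balance system decouples into one circulation problem per flow type, so it suffices to treat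
  a single network.  There, nontrivial circulations exist exactly when there is a cycle: the signed
  incidence vector of a cycle is one, and conversely, at every node a nonzero arc of a circulation
  has a second nonzero arc next to it, so a longest path through nonzero arcs closes up to a cycle.
  If \<open>T\<close> is connected, adding an arc closes a walk in \<open>T\<close> and thus creates a circulation.
  If \<open>T\<close> carries no circulation but \<open>T \<union> {e}\<close> does, then \<open>e\<close> carries nonzero flow, so it cannot
  be the only arc across the boundary of a node set; hence \<open>T\<close> already joins the ends of \<open>e\<close>.
\<close>

section \<open>Circulations of a single network and decoupling by flow type\<close>

definition net_outflow :: "'a rel \<Rightarrow> ('a \<times> 'a \<Rightarrow> real) \<Rightarrow> 'a \<Rightarrow> real" where
  "net_outflow V x i = (\<Sum>e\<in>V. x e * (of_bool (fst e = i) - of_bool (snd e = i)))"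

definition has_circulation :: "'a set \<Rightarrow> 'a rel \<Rightarrow> bool" where
  "has_circulation I V \<longleftrightarrow> (\<exists>x. (\<forall>i\<in>I. net_outflow V x i = 0) \<and> (\<exists>e\<in>V. x e \<noteq> 0))"

lemma net_outflow_zero [simp]: "net_outflow V (\<lambda>_. 0) i = 0"
  by (simp add: net_outflow_def)

lemma net_outflow_add:
  "net_outflow V (\<lambda>e. x e + y e) i = net_outflow V x i + net_outflow V y i"
  by (simp add: net_outflow_def distrib_right sum.distrib)

lemma net_outflow_single:
  assumes "finite V" "e \<in> V"
  shows "net_outflow V (\<lambda>f. if f = e then c else 0) i = c * (of_bool (fst e = i) - of_bool (snd e = i))"
proof -
  have "net_outflow V (\<lambda>f. if f = e then c else 0) i
      = (\<Sum>f\<in>V. if f = e then c * (of_bool (fst e = i) - of_bool (snd e = i)) else 0)"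
    unfolding net_outflow_def by (rule sum.cong) auto
  then show ?thesis using assms by simp
qed

text \<open>The right-hand side is a row of the incidence matrix applied to \<open>x\<close>. Unlike
  sums over neighbours, this single sum over arcs is visibly linear in the flow and can be exchanged
  with sums over nodes. As \<open>V\<close> lies in \<open>I \<times> I\<close>, restricting
  neighbours to \<open>I\<close> drops no arc.\<close>

lemma balance_eq_net_outflow:
  assumes "finite V" "V \<subseteq> I \<times> I"
  shows "(\<Sum>j\<in>out_nodes I V i. x (i, j)) - (\<Sum>j\<in>in_nodes I V i. x (j, i)) = net_outflow V x i"
proof -
  have "(\<Sum>e\<in>V. x e * of_bool (fst e = i)) = (\<Sum>e\<in>{e\<in>V. fst e = i}. x e)"
    using assms(1) by (simp add: sum.inter_filter of_bool_def if_distrib cong: if_cong)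
  also have "{e\<in>V. fst e = i} = Pair i ` out_nodes I V i"
    using assms(2) by (auto simp: out_nodes_def)
  also have "sum x \<dots> = (\<Sum>j\<in>out_nodes I V i. x (i, j))"
    by (subst sum.reindex) (auto simp: inj_on_def)
  finally have out: "(\<Sum>e\<in>V. x e * of_bool (fst e = i)) = (\<Sum>j\<in>out_nodes I V i. x (i, j))" .
  have "(\<Sum>e\<in>V. x e * of_bool (snd e = i)) = (\<Sum>e\<in>{e\<in>V. snd e = i}. x e)"
    using assms(1) by (simp add: sum.inter_filter of_bool_def if_distrib cong: if_cong)
  also have "{e\<in>V. snd e = i} = (\<lambda>j. (j, i)) ` in_nodes I V i"
    using assms(2) by (auto simp: in_nodes_def)
  also have "sum x \<dots> = (\<Sum>j\<in>in_nodes I V i. x (j, i))"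
    by (subst sum.reindex) (auto simp: inj_on_def)
  finally have "(\<Sum>e\<in>V. x e * of_bool (snd e = i)) = (\<Sum>j\<in>in_nodes I V i. x (j, i))" .
  with out show ?thesis
    by (simp add: net_outflow_def right_diff_distrib sum_subtractf)
qed

lemma has_nontrivial_homogeneous_solution_iff:
  assumes "\<And>k. k \<in> K \<Longrightarrow> finite (V k) \<and> V k \<subseteq> I k \<times> I k"
  shows "has_nontrivial_homogeneous_solution K I V \<longleftrightarrow> (\<exists>k\<in>K. has_circulation (I k) (V k))"
proof -
  have balance: "balance_system K I V (\<lambda>_ _. 0) x \<longleftrightarrow> (\<forall>k\<in>K. \<forall>i\<in>I k. net_outflow (V k) (x k) i = 0)" for x
    using assms by (simp add: balance_system_def balance_eq_net_outflow)
  show ?thesis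
  proof
    assume "has_nontrivial_homogeneous_solution K I V"
    then show "\<exists>k\<in>K. has_circulation (I k) (V k)"
      unfolding has_nontrivial_homogeneous_solution_def balance has_circulation_def by blast
  next
    assume "\<exists>k\<in>K. has_circulation (I k) (V k)"
    then obtain k y where k: "k \<in> K" "\<forall>i\<in>I k. net_outflow (V k) y i = 0" "\<exists>e\<in>V k. y e \<noteq> 0"
      unfolding has_circulation_def by blast
    \<comment> \<open>The circulation of type \<open>k\<close> is extended by zero flow in all other
      types.\<close>
    then have "balance_system K I V (\<lambda>_ _. 0) ((\<lambda>_ _. 0)(k := y))"
      unfolding balance by simp
    with k show "has_nontrivial_homogeneous_solution K I V"
      unfolding has_nontrivial_homogeneous_solution_def
      by (intro exI[of _ "(\<lambda>_ _. 0)(k := y)"]) auto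
  qed
qed

text \<open>Adding the balance equations over the nodes of \<open>C\<close> in \<open>I\<close>
  cancels every arc with both ends in \<open>C\<close>, so only the net flow across the boundary of
  \<open>C\<close> remains.\<close>

lemma circulation_cut:
  assumes "finite V" "finite I" "V \<subseteq> I \<times> I" "\<forall>i\<in>I. net_outflow V x i = 0"
  shows "(\<Sum>e\<in>V. x e * (of_bool (fst e \<in> C) - of_bool (snd e \<in> C))) = 0"
proof -
  have fin: "finite (C \<inter> I)" using assms(2) by simp
  have ind: "(\<Sum>i\<in>C \<inter> I. of_bool (v = i)) = (of_bool (v \<in> C) :: real)" if "v \<in> I" for v
    using fin that by (simp add: of_bool_def)
  have "0 = (\<Sum>i\<in>C \<inter> I. net_outflow V x i)"
    using assms(4) by simp
  also have "\<dots> = (\<Sum>e\<in>V. \<Sum>i\<in>C \<inter> I. x e * (of_bool (fst e = i) - of_bool (snd e = i)))"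
    unfolding net_outflow_def by (rule sum.swap)
  also have "\<dots> = (\<Sum>e\<in>V. x e * (of_bool (fst e \<in> C) - of_bool (snd e \<in> C)))"
  proof (rule sum.cong)
    fix e assume "e \<in> V"
    then have "fst e \<in> I" "snd e \<in> I" using assms(3) by auto
    then show "(\<Sum>i\<in>C \<inter> I. x e * (of_bool (fst e = i) - of_bool (snd e = i)))
        = x e * (of_bool (fst e \<in> C) - of_bool (snd e \<in> C))"
      by (simp add: sum_distrib_left[symmetric] sum_subtractf ind)
  qed simp
  finally show ?thesis by simp
qed

text \<open>If \<open>e\<close> were the only nonzero arc at \<open>u\<close>, the net outflow there
  would be \<open>x e\<close> up to sign, the coefficient being nonzero because \<open>e\<close> is
  not a loop.\<close>

lemma ex_second_nonzero_arc:
  assumes "finite V" "net_outflow V x u = 0" "e \<in> V" "x e \<noteq> 0" "fst e \<noteq> snd e" "fst e = u \<or> snd e = u"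
  shows "\<exists>f\<in>V. f \<noteq> e \<and> x f \<noteq> 0 \<and> (fst f = u \<or> snd f = u)"
proof (rule ccontr)
  assume "\<not> ?thesis"
  then have "(\<Sum>f\<in>V - {e}. x f * (of_bool (fst f = u) - of_bool (snd f = u))) = 0"
    by (intro sum.neutral) auto
  then have "net_outflow V x u = x e * (of_bool (fst e = u) - of_bool (snd e = u))"
    unfolding net_outflow_def using assms(1,3) by (simp add: sum.remove)
  with assms show False by auto
qed

section \<open>Walks ignoring orientation and the flows they carry\<close>

lemma traversal_simps [simp]:
  "verts (traversal G) = verts G"
  "arcs (traversal G) = arcs G \<times> UNIV"
  "tail (traversal G) (e, b) = (if b then tail G e else head G e)"
  "head (traversal G) (e, b) = (if b then head G e else tail G e)"
  by (auto simp: traversal_def)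

lemma (in wf_digraph) wf_digraph_traversal: "wf_digraph (traversal G)"
  by unfold_locales auto

lemma (in fin_digraph) fin_digraph_traversal: "fin_digraph (traversal G)"
proof -
  interpret T: wf_digraph "traversal G" by (rule wf_digraph_traversal)
  show ?thesis by unfold_locales auto
qed

lemma arcs_ends_traversal:
  "arcs_ends (traversal (with_proj G)) = parcs G \<union> (parcs G)\<inverse>"
proof -
  have "(u, v) \<in> arcs_ends (traversal (with_proj G))" if "(u, v) \<in> parcs G" for u v
    unfolding arcs_ends_conv by (rule image_eqI[where x = "((u, v), True)"]) (use that in auto)
  moreover have "(u, v) \<in> arcs_ends (traversal (with_proj G))" if "(v, u) \<in> parcs G" for u v
    unfolding arcs_ends_conv by (rule image_eqI[where x = "((v, u), False)"]) (use that in auto)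
  ultimately show ?thesis by (auto simp: arcs_ends_conv split: if_splits)
qed

text \<open>Connectedness is defined as strong connectedness of \<open>mk_symmetric\<close>, whose
  arc set is the symmetric closure; nonemptiness comes from strong connectedness.\<close>

lemma (in pair_wf_digraph) connected_iff:
  "Digraph_Component.connected (with_proj G) \<longleftrightarrow>
     pverts G \<noteq> {} \<and> (\<forall>u\<in>pverts G. \<forall>v\<in>pverts G. (u, v) \<in> (parcs G \<union> (parcs G)\<inverse>)\<^sup>*)"
proof -
  interpret M: pair_wf_digraph "mk_symmetric (with_proj G)" by (rule wellformed_mk_symmetric)
  have "parcs (mk_symmetric (with_proj G)) = parcs G \<union> (parcs G)\<inverse>"
    by (auto simp: parcs_mk_symmetric)
  then show ?thesis
    by (auto simp: Digraph_Component.connected_def strongly_connected_def M.reachable_conv')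
qed

text \<open>Counts the forward passes of an arc minus its backward passes.\<close>

definition walk_flow :: "('b \<times> bool) list \<Rightarrow> 'b \<Rightarrow> real" where
  "walk_flow p e = (\<Sum>(f, b)\<leftarrow>p. if e = f then if b then 1 else - 1 else 0)"

lemma walk_flow_simps [simp]:
  "walk_flow [] = (\<lambda>_. 0)"
  "walk_flow (a # p) = (\<lambda>e. (if e = fst a then if snd a then 1 else - 1 else 0) + walk_flow p e)"
  by (auto simp: walk_flow_def fun_eq_iff split: prod.split)

lemma walk_flow_notin: "e \<notin> fst ` set p \<Longrightarrow> walk_flow p e = 0"
  by (induction p) auto

context pair_fin_digraph
begin

interpretation T: fin_digraph "traversal (with_proj G)"
  by (rule fin_digraph_traversal)

text \<open>Each pass sends one unit from its tail to its head, so the contributions telescope along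
  the walk. In particular, closed walks yield balanced flows.\<close>

lemma net_outflow_walk_flow:
  assumes "T.awalk u p v"
  shows "net_outflow (parcs G) (walk_flow p) i = of_bool (u = i) - of_bool (v = i)"
  using assms
proof (induction p arbitrary: u)
  case Nil
  then show ?case by (simp add: T.awalk_Nil_iff)
next
  case (Cons a p)
  obtain e b where a: "a = (e, b)" by fastforce
  with Cons show ?case
    by (auto simp: T.awalk_Cons_iff net_outflow_add net_outflow_single)
qed

text \<open>A second pass of an arc, in either direction, would put both its ends on the rest of the
  path, including the node just left, which a path cannot revisit.\<close>

lemma apath_imp_distinct_arcs: "T.apath u p v \<Longrightarrow> distinct (map fst p)"
proof (induction p arbitrary: u)
  case (Cons a p)
  obtain e b where a: "a = (e, b)" by fastforce
  from Cons.prems have p: "T.apath (head (traversal G) a) p v"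
    and u: "tail (traversal G) a \<notin> set (T.awalk_verts (head (traversal G) a) p)"
    by (auto simp: T.apath_Cons_iff)
  have "e \<notin> fst ` set p"
  proof
    assume "e \<in> fst ` set p"
    then obtain c where c: "(e, c) \<in> set p" by force
    have "T.awalk (head (traversal G) a) p v" using p by (rule T.awalkI_apath)
    from T.awalk_verts_arc2[OF this c] T.awalk_verts_arc1[OF c] u show False
      unfolding a by (auto split: if_splits)
  qed
  with Cons.IH[OF p] a show ?case by simp
qed simp

section \<open>Cycles versus circulations\<close>

lemma cycle_imp_has_circulation:
  assumes "undirected_cycle (with_proj G) p"
  shows "has_circulation (pverts G) (parcs G)"
proof -
  from assms obtain u where u: "T.awalk u p u" "p \<noteq> []" and d: "distinct (map fst p)"
    by (auto simp: undirected_cycle_def T.cycle_def)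
  then obtain e b q where p: "p = (e, b) # q" by (metis list.exhaust surj_pair)
  with u have "e \<in> parcs G" by (auto simp: T.awalk_Cons_iff)
  \<comment> \<open>By distinctness \<open>e\<close> is passed only once, so its flow is 1 or -1 and
    no cancellation occurs.\<close>
  moreover have "walk_flow p e \<noteq> 0" using d p by (auto simp: walk_flow_notin)
  ultimately show ?thesis
    using net_outflow_walk_flow[OF u(1)] unfolding has_circulation_def by auto
qed

end

context pair_digraph
begin

interpretation T: fin_digraph "traversal (with_proj G)"
  by (rule fin_digraph_traversal)

lemma has_circulation_imp_cycle:
  assumes "has_circulation (pverts G) (parcs G)"
  shows "\<exists>p. undirected_cycle (with_proj G) p"
proof -
  from assms obtain x e\<^sub>0 where x: "\<forall>i\<in>pverts G. net_outflow (parcs G) x i = 0"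
    and e\<^sub>0: "e\<^sub>0 \<in> parcs G" "x e\<^sub>0 \<noteq> 0"
    unfolding has_circulation_def by blast
  \<comment> \<open>Simple paths through nonzero arcs; their length is bounded by the number of
    nodes, so a longest one exists.\<close>
  let ?P = "\<lambda>p. p \<noteq> [] \<and> (\<exists>u v. T.apath u p v) \<and> (\<forall>e\<in>fst ` set p. x e \<noteq> 0)"
  have "?P [(e\<^sub>0, True)]"
    using e\<^sub>0 by (auto simp: T.apath_simps no_loops' arc_fst_in_verts arc_snd_in_verts no_loops)
  moreover have "\<forall>p. ?P p \<longrightarrow> length p < Suc (card (pverts G))"
    using T.length_apath by (fastforce simp: less_Suc_eq_le)
  ultimately obtain p where p: "?P p" and max: "\<And>q. ?P q \<Longrightarrow> length q \<le> length p"
    using ex_has_greatest_nat[of ?P "[(e\<^sub>0, True)]" length "Suc (card (pverts G))"] by blast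
  then obtain u v where path: "T.apath u p v" by blast
  obtain e b p' where p_eq: "p = (e, b) # p'" using p by (metis list.exhaust surj_pair)
  let ?w = "head (traversal (with_proj G)) (e, b)"
  from path have e: "e \<in> parcs G" "tail (traversal (with_proj G)) (e, b) = u"
    and path': "T.apath ?w p' v" "u \<notin> set (T.awalk_verts ?w p')"
    by (auto simp: p_eq T.apath_Cons_iff)
  have "u \<in> pverts G" using path by (auto simp: T.apath_def)
  moreover have "fst e = u \<or> snd e = u" using e by (auto split: if_splits)
  moreover have "x e \<noteq> 0" using p by (auto simp: p_eq)
  ultimately obtain f where f: "f \<in> parcs G" "f \<noteq> e" "x f \<noteq> 0" "fst f = u \<or> snd f = u"
    using ex_second_nonzero_arc[of "parcs G" x u e] x e(1) pair_finite_arcs no_loops by blast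
  \<comment> \<open>The direction \<open>c\<close> makes \<open>f\<close> enter \<open>u\<close>, so
    that it can be put in front of \<open>p\<close>.\<close>
  obtain c where c: "head (traversal (with_proj G)) (f, c) = u"
    using f(4) by (metis traversal_simps(4) with_proj_simps(4,5))
  define w where "w = tail (traversal (with_proj G)) (f, c)"
  \<comment> \<open>The first arc of \<open>p\<close> is \<open>e\<close>, which differs from
    \<open>f\<close>; a later occurrence of \<open>f\<close> would bring the path back to
    \<open>u\<close>.\<close>
  have f_notin: "f \<notin> fst ` set p"
  proof
    assume "f \<in> fst ` set p"
    then obtain d where d: "(f, d) \<in> set p'" using f(2) by (auto simp: p_eq)
    have "T.awalk ?w p' v" using path'(1) by (rule T.awalkI_apath)
    from T.awalk_verts_arc2[OF this d] T.awalk_verts_arc1[OF d, of ?w] path'(2) f(4)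
    show False by (auto split: if_splits)
  qed
  \<comment> \<open>Otherwise prepending \<open>f\<close> would give a longer path, against
    maximality.\<close>
  have "w \<in> set (T.awalk_verts u p)"
  proof (rule ccontr)
    assume "w \<notin> set (T.awalk_verts u p)"
    then have "T.apath w ((f, c) # p) v"
      unfolding T.apath_Cons_iff using path c f(1) w_def by simp
    then have "?P ((f, c) # p)" using p f(3) by auto
    from max[OF this] show False by simp
  qed
  moreover have "T.awalk u p v" using path by (rule T.awalkI_apath)
  \<comment> \<open>The prefix \<open>q\<close> leads from \<open>u\<close> to \<open>w\<close>, and
    \<open>f\<close> leads back from \<open>w\<close> to \<open>u\<close>: together they form the
    cycle.\<close>
  ultimately obtain q r where qr: "p = q @ r" "T.awalk u q w"
    using T.awalk_decomp by blast
  with path have q: "T.apath u q w"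
    by (auto simp: T.apath_append_iff)
  have "T.awalk w ((f, c) # q) w"
    unfolding T.awalk_Cons_iff using qr(2) c f(1) w_def by simp
  moreover have "distinct (tl (T.awalk_verts w ((f, c) # q)))"
    using q c by (simp add: T.apath_def)
  ultimately have "T.cycle ((f, c) # q)" unfolding T.cycle_def by blast
  moreover have "distinct (map fst ((f, c) # q))"
    using apath_imp_distinct_arcs[OF q] f_notin qr(1) by auto
  ultimately show ?thesis unfolding undirected_cycle_def by blast
qed

lemma has_circulation_iff_cycle:
  "has_circulation (pverts G) (parcs G) \<longleftrightarrow> (\<exists>p. undirected_cycle (with_proj G) p)"
  using has_circulation_imp_cycle cycle_imp_has_circulation by blast

section \<open>Circulations created by an additional arc\<close>

lemma has_circulation_insert:
  assumes "(u, v) \<notin> parcs G" "u \<in> pverts G" "v \<in> pverts G"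
    and "(v, u) \<in> (parcs G \<union> (parcs G)\<inverse>)\<^sup>*"
  shows "has_circulation (pverts G) (insert (u, v) (parcs G))"
proof -
  let ?H = "\<lparr> pverts = pverts G, parcs = insert (u, v) (parcs G) \<rparr>"
  interpret H: pair_fin_digraph ?H
    by unfold_locales (use assms pair_finite_verts pair_finite_arcs in \<open>auto dest: in_arcsD1 in_arcsD2\<close>)
  interpret HT: fin_digraph "traversal (with_proj ?H)"
    by (rule H.fin_digraph_traversal)
  have "reachable (traversal (with_proj G)) v u"
    using assms by (simp add: T.reachable_conv' arcs_ends_traversal)
  then obtain p where p: "T.awalk v p u" by (auto simp: T.reachable_awalk)
  \<comment> \<open>Both traversals have the same tail and head functions, so walks in
    \<open>G\<close> remain walks after the insertion.\<close>
  have eqs: "HT.cas = T.cas"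
    by (rule compatible_cas) (simp add: compatible_def traversal_def fun_eq_iff)
  have "HT.awalk u (((u, v), True) # p) u"
    using p assms by (auto simp: HT.awalk_def T.awalk_def eqs)
  from H.net_outflow_walk_flow[OF this]
  have "\<forall>i\<in>pverts G. net_outflow (insert (u, v) (parcs G)) (walk_flow (((u, v), True) # p)) i = 0"
    by simp
  \<comment> \<open>The walk back from \<open>v\<close> to \<open>u\<close> stays in
    \<open>G\<close>, so the new arc is passed exactly once and carries flow 1.\<close>
  moreover have "(u, v) \<notin> fst ` set p" using p assms(1) by (auto simp: T.awalk_def)
  then have "walk_flow (((u, v), True) # p) (u, v) \<noteq> 0" by (simp add: walk_flow_notin)
  ultimately show ?thesis unfolding has_circulation_def by blast
qed

lemma has_circulation_insertD:
  assumes circ: "has_circulation (pverts G) (insert (u, v) (parcs G))"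
    and no_circ: "\<not> has_circulation (pverts G) (parcs G)"
    and uv: "(u, v) \<notin> parcs G" "u \<in> pverts G" "v \<in> pverts G"
  shows "(u, v) \<in> (parcs G \<union> (parcs G)\<inverse>)\<^sup>*"
proof (rule ccontr)
  assume neg: "\<not> ?thesis"
  let ?V = "insert (u, v) (parcs G)"
  \<comment> \<open>The component of \<open>u\<close> in \<open>G\<close> ignoring orientation: no
    arc of \<open>G\<close> crosses its boundary, whereas \<open>(u, v)\<close> would by assumption,
    forcing zero flow on it.\<close>
  let ?C = "{w. (u, w) \<in> (parcs G \<union> (parcs G)\<inverse>)\<^sup>*}"
  have sub: "?V \<subseteq> pverts G \<times> pverts G"
    using uv by (auto dest: in_arcsD1 in_arcsD2)
  from circ obtain x where x: "\<forall>i\<in>pverts G. net_outflow ?V x i = 0" "\<exists>e\<in>?V. x e \<noteq> 0"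
    unfolding has_circulation_def by blast
  have "fst e \<in> ?C \<longleftrightarrow> snd e \<in> ?C" if "e \<in> parcs G" for e
  proof -
    have "(fst e, snd e) \<in> parcs G \<union> (parcs G)\<inverse>" "(snd e, fst e) \<in> parcs G \<union> (parcs G)\<inverse>"
      using that by auto
    then show ?thesis by (auto intro: rtrancl_into_rtrancl)
  qed
  then have "(\<Sum>e\<in>parcs G. x e * (of_bool (fst e \<in> ?C) - of_bool (snd e \<in> ?C))) = 0"
    by (intro sum.neutral) auto
  moreover have "(\<Sum>e\<in>?V. x e * (of_bool (fst e \<in> ?C) - of_bool (snd e \<in> ?C))) = 0"
    using circulation_cut[OF _ _ sub x(1)] pair_finite_arcs pair_finite_verts by blast
  ultimately have "x (u, v) = 0"
    using uv(1) neg pair_finite_arcs by simp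
  \<comment> \<open>With no flow on the new arc, \<open>x\<close> is already a circulation of
    \<open>G\<close>, and its nonzero arc lies in \<open>G\<close>.\<close>
  then have "net_outflow ?V x i = net_outflow (parcs G) x i" for i
    unfolding net_outflow_def using uv(1) pair_finite_arcs by simp
  with x \<open>x (u, v) = 0\<close> have "has_circulation (pverts G) (parcs G)"
    unfolding has_circulation_def by auto
  with no_circ show False ..
qed

text \<open>Absence of circulations is acyclicity and occurs on both sides. Under it, connectedness
  of \<open>T\<close> has to be matched with the effect of adding any further arc.\<close>

lemma spanning_tree_arcs_iff:
  assumes conn: "Digraph_Component.connected (with_proj G)" and T: "T \<subseteq> parcs G"
  shows "spanning_tree_arcs T G \<longleftrightarrow>
    \<not> has_circulation (pverts G) T \<and> (\<forall>e\<in>parcs G - T. has_circulation (pverts G) (insert e T))"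
proof -
  let ?H = "\<lparr> pverts = pverts G, parcs = T \<rparr>"
  interpret H: pair_digraph ?H
    by unfold_locales
      (use T pair_finite_verts pair_finite_arcs in
        \<open>auto dest!: subsetD[OF T] dest: in_arcsD1 in_arcsD2 no_loops' finite_subset\<close>)
  have "spanning (with_proj ?H) (with_proj G)"
    using T H.wf_digraph wf_digraph
    by (auto simp: spanning_def intro!: subgraphI)
  then have tree: "spanning_tree_arcs T G \<longleftrightarrow>
      Digraph_Component.connected (with_proj ?H) \<and> \<not> has_circulation (pverts G) T"
    using H.has_circulation_iff_cycle by (simp add: spanning_tree_arcs_def undirected_tree_def Let_def)
  have connG: "pverts G \<noteq> {}" "\<forall>u\<in>pverts G. \<forall>v\<in>pverts G. (u, v) \<in> (parcs G \<union> (parcs G)\<inverse>)\<^sup>*"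
    using conn connected_iff by auto
  have connH: "Digraph_Component.connected (with_proj ?H) \<longleftrightarrow>
      (\<forall>u\<in>pverts G. \<forall>v\<in>pverts G. (u, v) \<in> (T \<union> T\<inverse>)\<^sup>*)"
    using H.connected_iff connG(1) by simp
  have "Digraph_Component.connected (with_proj ?H) \<longleftrightarrow>
      (\<forall>e\<in>parcs G - T. has_circulation (pverts G) (insert e T))"
    if no_circ: "\<not> has_circulation (pverts G) T"
  proof
    assume conn': "Digraph_Component.connected (with_proj ?H)"
    show "\<forall>e\<in>parcs G - T. has_circulation (pverts G) (insert e T)"
    proof
      fix e assume "e \<in> parcs G - T"
      moreover obtain u v where "e = (u, v)" by fastforce
      ultimately show "has_circulation (pverts G) (insert e T)"
        using H.has_circulation_insert[of u v] connH conn' in_arcsD1[of u v] in_arcsD2[of u v] by simp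
    qed
  next
    assume circ: "\<forall>e\<in>parcs G - T. has_circulation (pverts G) (insert e T)"
    have "(u, v) \<in> (T \<union> T\<inverse>)\<^sup>*" if "(u, v) \<in> parcs G" for u v
      using H.has_circulation_insertD[of u v] circ no_circ that
      by (cases "(u, v) \<in> T") (auto dest: in_arcsD1 in_arcsD2)
    moreover have "sym ((T \<union> T\<inverse>)\<^sup>*)" by (intro sym_rtrancl sym_Un_converse)
    \<comment> \<open>Every arc of \<open>G\<close> can be replaced by a walk in \<open>T\<close>,
      so \<open>T\<close> inherits connectedness from \<open>G\<close>.\<close>
    ultimately have "parcs G \<union> (parcs G)\<inverse> \<subseteq> (T \<union> T\<inverse>)\<^sup>*"
      by (auto dest: symD)
    then have "(parcs G \<union> (parcs G)\<inverse>)\<^sup>* \<subseteq> (T \<union> T\<inverse>)\<^sup>*"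
      by (rule rtrancl_subset_rtrancl)
    with connG(2) connH show "Digraph_Component.connected (with_proj ?H)" by blast
  qed
  with tree show ?thesis by blast
qed

end

section \<open>Assembling all flow types\<close>

theorem theorem2:
  fixes S :: "'a pair_pre_digraph"
    and K :: "nat set"
    and N :: "nat \<Rightarrow> 'a pair_pre_digraph"
    and a :: "nat \<Rightarrow> 'a \<Rightarrow> real"
    and U\<^sub>T :: "nat \<Rightarrow> ('a \<times> 'a) set"
  assumes "pair_digraph S"
    and "Digraph_Component.connected (with_proj S)"
    and "K = {1..card K}"
    and "\<And>k. k \<in> K \<Longrightarrow> subgraph (with_proj (N k)) (with_proj S)"
    and "\<And>k. k \<in> K \<Longrightarrow> Digraph_Component.connected (with_proj (N k))"
    and "\<And>k. k \<in> K \<Longrightarrow> U\<^sub>T k \<subseteq> parcs (N k)"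
  shows "is_support K (\<lambda>k. pverts (N k)) (\<lambda>k. parcs (N k)) a U\<^sub>T
    \<longleftrightarrow> (\<forall>k\<in>K. spanning_tree_arcs (U\<^sub>T k) (N k))"
proof -
  interpret S: pair_digraph S by fact
  have N: "pair_digraph (N k)" if "k \<in> K" for k
  proof -
    interpret D: digraph "with_proj (N k)"
      using S.digraph_subgraph assms(4)[OF that] by blast
    show ?thesis
      using D.wellformed D.finite_arcs D.finite_verts D.no_loops by unfold_locales auto
  qed
  have wf: "finite (parcs (N k)) \<and> parcs (N k) \<subseteq> pverts (N k) \<times> pverts (N k)" if "k \<in> K" for k
  proof -
    interpret D: pair_digraph "N k" using N that by blast
    show ?thesis using D.pair_finite_arcs by (auto dest: D.in_arcsD1 D.in_arcsD2)
  qed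
  have sub: "finite V \<and> V \<subseteq> pverts (N k) \<times> pverts (N k)" if "k \<in> K" "V \<subseteq> parcs (N k)" for k V
    using wf[OF that(1)] that(2) finite_subset by blast
  have base: "has_nontrivial_homogeneous_solution K (\<lambda>k. pverts (N k)) U\<^sub>T \<longleftrightarrow>
      (\<exists>k\<in>K. has_circulation (pverts (N k)) (U\<^sub>T k))"
    using sub assms(6) by (intro has_nontrivial_homogeneous_solution_iff) blast
  have extended: "has_nontrivial_homogeneous_solution K (\<lambda>k. pverts (N k)) (U\<^sub>T(k\<^sub>0 := U\<^sub>T k\<^sub>0 \<union> {e})) \<longleftrightarrow>
      (\<exists>k\<in>K. has_circulation (pverts (N k)) ((U\<^sub>T(k\<^sub>0 := U\<^sub>T k\<^sub>0 \<union> {e})) k))"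
    if "k\<^sub>0 \<in> K" "e \<in> parcs (N k\<^sub>0) - U\<^sub>T k\<^sub>0" for k\<^sub>0 e
  proof (intro has_nontrivial_homogeneous_solution_iff sub)
    fix k assume "k \<in> K"
    then show "(U\<^sub>T(k\<^sub>0 := U\<^sub>T k\<^sub>0 \<union> {e})) k \<subseteq> parcs (N k)"
      using assms(6) that by auto
  qed
  have "is_support K (\<lambda>k. pverts (N k)) (\<lambda>k. parcs (N k)) a U\<^sub>T \<longleftrightarrow>
      (\<forall>k\<in>K. \<not> has_circulation (pverts (N k)) (U\<^sub>T k)) \<and>
      (\<forall>k\<in>K. \<forall>e\<in>parcs (N k) - U\<^sub>T k. has_circulation (pverts (N k)) (insert e (U\<^sub>T k)))"
  \<comment> \<open>If no \<open>U\<^sub>T k\<close> carries a circulation, one in the family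
    extended by \<open>e\<close> must be of type \<open>k\<^sub>0\<close>, the only type that
    changed. Otherwise both sides are false.\<close>
  proof (cases "\<forall>k\<in>K. \<not> has_circulation (pverts (N k)) (U\<^sub>T k)")
    case True
    then have "(\<exists>k\<in>K. has_circulation (pverts (N k)) ((U\<^sub>T(k\<^sub>0 := U\<^sub>T k\<^sub>0 \<union> {e})) k)) \<longleftrightarrow>
        has_circulation (pverts (N k\<^sub>0)) (insert e (U\<^sub>T k\<^sub>0))" if "k\<^sub>0 \<in> K" for k\<^sub>0 e
      using that by (auto split: if_splits)
    with True base extended assms(6) show ?thesis
      unfolding is_support_def by simp
  next
    case False
    with base show ?thesis unfolding is_support_def by blast
  qed
  moreover have "spanning_tree_arcs (U\<^sub>T k) (N k) \<longleftrightarrow>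
      \<not> has_circulation (pverts (N k)) (U\<^sub>T k) \<and>
      (\<forall>e\<in>parcs (N k) - U\<^sub>T k. has_circulation (pverts (N k)) (insert e (U\<^sub>T k)))" if "k \<in> K" for k
    using pair_digraph.spanning_tree_arcs_iff[OF N[OF that] assms(5)[OF that] assms(6)[OF that]] .
  ultimately show ?thesis by blast
qed

end
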